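(* Let $\Sigma$ be a set of canonical DTGDs, $D$ a database and $q$ a Boolean UCQ. Then $D\cup\Sigma\vDash q$ if and only if $chase(D,\Sigma)\vDash q$.
   Context: Terms are constants, labeled nulls, or variables. A fact is a variable-free relational atom (it may contain nulls); an instance is a set of facts; a database is a finite instance without nulls. A Boolean UCQ is a sentence built from relational atoms using only $\wedge,\vee,\exists$. A DTGD is a sentence $\forall\mathbf x\forall\mathbf y(\phi(\mathbf x,\mathbf y)\rightarrow\exists\mathbf z(\psi_1(\mathbf x,\mathbf z)\vee\dots\vee\psi_k(\mathbf x,\mathbf z)))$ with $\phi$, $\psi_i$ conjunctions of relational atoms, each variable of $\mathbf x$ occurring in $\phi$; it is canonical if each $\psi_i$ is a single atom; $head(\sigma)=\{\psi_1,\dots,\psi_k\}$. $D\cup\Sigma\vDash q$ means every instance containing $D$ and satisfying all DTGDs of $\Sigma$ satisfies $q$. Nondeterministic chase: a nondeterministic fact is a finite nonempty set of facts (read as their disjunction); a nondeterministic instance is a set of these. For a canonical DTGD $\sigma$ with body atoms $\alpha_1,\dots,\alpha_n$ and frontier tuple $\mathbf x$ (variables in both body and head), $\sigma$ is applicable to a nondeterministic instance $I$ via a substitution $h$ (variables to constants/nulls) and a tuple $\mathbf F=(F_1,\dots,F_n)$ of elements of $I$ if $h(\alpha_i)\in F_i$ for all $i$; the result is $res(\mathbf F,\sigma,h)=h'(head(\sigma))\cup\bigcup_{i=1}^n(F_i\setminus\{h(\alpha_i)\})$, where $h'$ extends $h$ by sending each existential variable $v$ to a null assigned one-to-one to the triple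 $(\sigma,h(\mathbf x),v)$. Set $chase_0(D,\Sigma)=\{\{\alpha\}:\alpha\in D\}$, $chase_k(D,\Sigma)$ the union of $chase_{k-1}(D,\Sigma)$ with all results of applying some $\sigma\in\Sigma$ to $chase_{k-1}(D,\Sigma)$, and $chase(D,\Sigma)=\bigcup_kchase_k(D,\Sigma)$. $chase(D,\Sigma)\vDash q$ means every instance $I$ (nulls treated as domain elements) with $I\cap F\neq\emptyset$ for all $F\in chase(D,\Sigma)$ satisfies $q$. *)

theory Defs
  imports Main
begin

text \<open>
  Terms occurring in sentences are constants or variables; facts are built from constants and
  labeled nulls, which together form the domain of every instance.  An atom is a predicate symbol
  with an argument list, so arities are not declared: a symbol used with argument lists of
  different lengths behaves like different symbols.
\<close>

datatype ('c, 'v) trm = Cst 'c | Var 'v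

datatype ('c, 'n) val = Const 'c | Null 'n

datatype ('p, 't) atom = Atom (pred: 'p) (args: "'t list")

type_synonym ('p, 'c, 'v) ratom = "('p, ('c, 'v) trm) atom"
type_synonym ('p, 'c, 'n) fact = "('p, ('c, 'n) val) atom"
type_synonym ('p, 'c, 'n) inst = "('p, 'c, 'n) fact set"

definition null_free :: "('p, 'c, 'n) fact \<Rightarrow> bool" where
  "null_free \<alpha> \<longleftrightarrow> (\<forall>t \<in> set (args \<alpha>). \<exists>c. t = Const c)"

definition database :: "('p, 'c, 'n) inst \<Rightarrow> bool" where
  "database D \<longleftrightarrow> finite D \<and> (\<forall>\<alpha>\<in>D. null_free \<alpha>)"

primrec val_of :: "('v \<Rightarrow> ('c, 'n) val) \<Rightarrow> ('c, 'v) trm \<Rightarrow> ('c, 'n) val" where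
  "val_of h (Cst c) = Const c"
| "val_of h (Var v) = h v"

definition app :: "('v \<Rightarrow> ('c, 'n) val) \<Rightarrow> ('p, 'c, 'v) ratom \<Rightarrow> ('p, 'c, 'n) fact" where
  "app h a = Atom (pred a) (map (val_of h) (args a))"

primrec trm_vars :: "('c, 'v) trm \<Rightarrow> 'v list" where
  "trm_vars (Cst c) = []"
| "trm_vars (Var v) = [v]"

definition atom_vars :: "('p, 'c, 'v) ratom \<Rightarrow> 'v list" where
  "atom_vars a = concat (map trm_vars (args a))"


section \<open>Boolean unions of conjunctive queries\<close>

datatype ('p, 'c, 'v) query =
    QAtom "('p, 'c, 'v) ratom"
  | QAnd "('p, 'c, 'v) query" "('p, 'c, 'v) query"
  | QOr "('p, 'c, 'v) query" "('p, 'c, 'v) query"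
  | QEx 'v "('p, 'c, 'v) query"

primrec free_vars :: "('p, 'c, 'v) query \<Rightarrow> 'v set" where
  "free_vars (QAtom a) = set (atom_vars a)"
| "free_vars (QAnd p q) = free_vars p \<union> free_vars q"
| "free_vars (QOr p q) = free_vars p \<union> free_vars q"
| "free_vars (QEx v q) = free_vars q - {v}"

definition boolean_ucq :: "('p, 'c, 'v) query \<Rightarrow> bool" where
  "boolean_ucq q \<longleftrightarrow> free_vars q = {}"

primrec holds :: "('p, 'c, 'n) inst \<Rightarrow> ('v \<Rightarrow> ('c, 'n) val) \<Rightarrow> ('p, 'c, 'v) query \<Rightarrow> bool" where
  "holds I h (QAtom a) \<longleftrightarrow> app h a \<in> I"
| "holds I h (QAnd p q) \<longleftrightarrow> holds I h p \<and> holds I h q"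
| "holds I h (QOr p q) \<longleftrightarrow> holds I h p \<or> holds I h q"
| "holds I h (QEx v q) \<longleftrightarrow> (\<exists>t. holds I (h(v := t)) q)"

text \<open>For sentences the choice of the assignment \<open>h\<close> is immaterial.\<close>

definition sat_query :: "('p, 'c, 'n) inst \<Rightarrow> ('p, 'c, 'v) query \<Rightarrow> bool" where
  "sat_query I q \<longleftrightarrow> (\<forall>h. holds I h q)"

lemma app_cong: "(\<And>v. v \<in> set (atom_vars a) \<Longrightarrow> h v = h' v) \<Longrightarrow> app h a = app h' a"
proof -
  assume eq: "\<And>v. v \<in> set (atom_vars a) \<Longrightarrow> h v = h' v"
  have "val_of h t = val_of h' t" if "t \<in> set (args a)" for t
  proof (cases t)
    case (Var v)
    with that have "v \<in> set (atom_vars a)"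
      unfolding atom_vars_def by (auto intro!: bexI[of _ t])
    with Var eq show ?thesis by simp
  qed simp
  then show ?thesis by (simp add: app_def)
qed

lemma holds_cong: "(\<And>v. v \<in> free_vars q \<Longrightarrow> h v = h' v) \<Longrightarrow> holds I h q \<longleftrightarrow> holds I h' q"
proof (induction q arbitrary: h h')
  case (QAtom a)
  then have "app h a = app h' a" by (intro app_cong) simp
  then show ?case by simp
next
  case (QAnd p q)
  have "holds I h p \<longleftrightarrow> holds I h' p" "holds I h q \<longleftrightarrow> holds I h' q"
    by (rule QAnd.IH; simp add: QAnd.prems)+
  then show ?case by simp
next
  case (QOr p q)
  have "holds I h p \<longleftrightarrow> holds I h' p" "holds I h q \<longleftrightarrow> holds I h' q"
    by (rule QOr.IH; simp add: QOr.prems)+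
  then show ?case by simp
next
  case (QEx v q)
  have "holds I (h(v := t)) q \<longleftrightarrow> holds I (h'(v := t)) q" for t
    using QEx.prems by (intro QEx.IH) auto
  then show ?case by simp
qed

lemma sat_query_sentence: "boolean_ucq q \<Longrightarrow> sat_query I q \<longleftrightarrow> holds I h q"
proof -
  assume "boolean_ucq q"
  then have "holds I h q \<longleftrightarrow> holds I h' q" for h'
    by (intro holds_cong) (simp add: boolean_ucq_def)
  then show ?thesis by (auto simp: sat_query_def)
qed


section \<open>Disjunctive tuple-generating dependencies\<close>

text \<open>
  \<open>DTGD [a\<^sub>1, \<dots>, a\<^sub>n] [\<psi>\<^sub>1, \<dots>, \<psi>\<^sub>k]\<close> with each \<open>\<psi>\<^sub>i\<close> a list of atoms stands for the sentence
  with body \<open>a\<^sub>1 \<and> \<dots> \<and> a\<^sub>n\<close> and head \<open>\<psi>\<^sub>1 \<or> \<dots> \<or> \<psi>\<^sub>k\<close>.  The quantifier prefix is left implicit: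
  the variables of the body are universally quantified, and the variables occurring only in the
  head are existentially quantified in front of the disjunction.  An empty body is allowed and
  read as true; the head is a nonempty disjunction of nonempty conjunctions.
\<close>

datatype ('p, 'c, 'v) dtgd =
  DTGD (body: "('p, 'c, 'v) ratom list") (disjuncts: "('p, 'c, 'v) ratom list list")

definition wf_dtgd :: "('p, 'c, 'v) dtgd \<Rightarrow> bool" where
  "wf_dtgd \<sigma> \<longleftrightarrow> disjuncts \<sigma> \<noteq> [] \<and> (\<forall>\<psi> \<in> set (disjuncts \<sigma>). \<psi> \<noteq> [])"

definition canonical :: "('p, 'c, 'v) dtgd \<Rightarrow> bool" where
  "canonical \<sigma> \<longleftrightarrow> (\<forall>\<psi> \<in> set (disjuncts \<sigma>). length \<psi> = 1)"

definition head_atoms :: "('p, 'c, 'v) dtgd \<Rightarrow> ('p, 'c, 'v) ratom set" where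
  "head_atoms \<sigma> = (\<Union>\<psi> \<in> set (disjuncts \<sigma>). set \<psi>)"

definition body_vars :: "('p, 'c, 'v) dtgd \<Rightarrow> 'v list" where
  "body_vars \<sigma> = remdups (concat (map atom_vars (body \<sigma>)))"

definition head_vars :: "('p, 'c, 'v) dtgd \<Rightarrow> 'v set" where
  "head_vars \<sigma> = (\<Union>a \<in> head_atoms \<sigma>. set (atom_vars a))"

text \<open>The frontier tuple; any fixed repetition-free enumeration would do.\<close>

definition frontier :: "('p, 'c, 'v) dtgd \<Rightarrow> 'v list" where
  "frontier \<sigma> = filter (\<lambda>v. v \<in> head_vars \<sigma>) (body_vars \<sigma>)"

definition ex_vars :: "('p, 'c, 'v) dtgd \<Rightarrow> 'v set" where
  "ex_vars \<sigma> = head_vars \<sigma> - set (body_vars \<sigma>)"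

definition sat_dtgd :: "('p, 'c, 'n) inst \<Rightarrow> ('p, 'c, 'v) dtgd \<Rightarrow> bool" where
  "sat_dtgd I \<sigma> \<longleftrightarrow>
     (\<forall>h. (\<forall>a \<in> set (body \<sigma>). app h a \<in> I) \<longrightarrow>
       (\<exists>h'. (\<forall>v \<in> set (body_vars \<sigma>). h' v = h v) \<and>
         (\<exists>\<psi> \<in> set (disjuncts \<sigma>). \<forall>a \<in> set \<psi>. app h' a \<in> I)))"

definition entails ::
  "('p, 'c, 'n) inst \<Rightarrow> ('p, 'c, 'v) dtgd set \<Rightarrow> ('p, 'c, 'v) query \<Rightarrow> bool" where
  "entails D \<Sigma> q \<longleftrightarrow> (\<forall>I. D \<subseteq> I \<and> (\<forall>\<sigma>\<in>\<Sigma>. sat_dtgd I \<sigma>) \<longrightarrow> sat_query I q)"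


section \<open>The nondeterministic chase\<close>

type_synonym ('p, 'c, 'n) nfact = "('p, 'c, 'n) fact set"
type_synonym ('p, 'c, 'n) ninst = "('p, 'c, 'n) nfact set"

definition nondet_instance :: "('p, 'c, 'n) ninst \<Rightarrow> bool" where
  "nondet_instance I \<longleftrightarrow> (\<forall>F\<in>I. finite F \<and> F \<noteq> {})"

text \<open>A null naming assigns nulls to triples \<open>(\<sigma>, h(x), v)\<close> with \<open>x\<close> the frontier tuple and
  \<open>v\<close> an existential variable of \<open>\<sigma>\<close>; it is required to be one-to-one on these triples.\<close>

type_synonym ('p, 'c, 'v, 'n) naming = "('p, 'c, 'v) dtgd \<times> ('c, 'n) val list \<times> 'v \<Rightarrow> 'n"

definition null_triples ::
  "('p, 'c, 'v) dtgd set \<Rightarrow> (('p, 'c, 'v) dtgd \<times> ('c, 'n) val list \<times> 'v) set" where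
  "null_triples \<Sigma> = {(\<sigma>, ts, v). \<sigma> \<in> \<Sigma> \<and> length ts = length (frontier \<sigma>) \<and> v \<in> ex_vars \<sigma>}"

definition null_naming :: "('p, 'c, 'v) dtgd set \<Rightarrow> ('p, 'c, 'v, 'n) naming \<Rightarrow> bool" where
  "null_naming \<Sigma> \<nu> \<longleftrightarrow> inj_on \<nu> (null_triples \<Sigma>)"

definition extend ::
  "('p, 'c, 'v, 'n) naming \<Rightarrow> ('p, 'c, 'v) dtgd \<Rightarrow> ('v \<Rightarrow> ('c, 'n) val) \<Rightarrow> 'v \<Rightarrow> ('c, 'n) val" where
  "extend \<nu> \<sigma> h v =
     (if v \<in> ex_vars \<sigma> then Null (\<nu> (\<sigma>, map h (frontier \<sigma>), v)) else h v)"

definition applicable ::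
  "('p, 'c, 'n) ninst \<Rightarrow> ('p, 'c, 'v) dtgd \<Rightarrow> ('v \<Rightarrow> ('c, 'n) val) \<Rightarrow> ('p, 'c, 'n) nfact list \<Rightarrow> bool"
  where
  "applicable I \<sigma> h Fs \<longleftrightarrow>
     set Fs \<subseteq> I \<and> length Fs = length (body \<sigma>) \<and>
     (\<forall>i < length (body \<sigma>). app h (body \<sigma> ! i) \<in> Fs ! i)"

definition res ::
  "('p, 'c, 'v, 'n) naming \<Rightarrow> ('p, 'c, 'n) nfact list \<Rightarrow> ('p, 'c, 'v) dtgd \<Rightarrow>
   ('v \<Rightarrow> ('c, 'n) val) \<Rightarrow> ('p, 'c, 'n) nfact" where
  "res \<nu> Fs \<sigma> h =
     app (extend \<nu> \<sigma> h) ` head_atoms \<sigma> \<union>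
     (\<Union>i < length (body \<sigma>). Fs ! i - {app h (body \<sigma> ! i)})"

primrec chase_step ::
  "('p, 'c, 'v, 'n) naming \<Rightarrow> ('p, 'c, 'n) inst \<Rightarrow> ('p, 'c, 'v) dtgd set \<Rightarrow> nat \<Rightarrow> ('p, 'c, 'n) ninst"
  where
  "chase_step \<nu> D \<Sigma> 0 = {{\<alpha>} |\<alpha>. \<alpha> \<in> D}"
| "chase_step \<nu> D \<Sigma> (Suc k) =
     chase_step \<nu> D \<Sigma> k \<union>
     {res \<nu> Fs \<sigma> h |Fs \<sigma> h. \<sigma> \<in> \<Sigma> \<and> applicable (chase_step \<nu> D \<Sigma> k) \<sigma> h Fs}"

definition chase ::
  "('p, 'c, 'v, 'n) naming \<Rightarrow> ('p, 'c, 'n) inst \<Rightarrow> ('p, 'c, 'v) dtgd set \<Rightarrow> ('p, 'c, 'n) ninst" where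
  "chase \<nu> D \<Sigma> = (\<Union>k. chase_step \<nu> D \<Sigma> k)"

definition nentails :: "('p, 'c, 'n) ninst \<Rightarrow> ('p, 'c, 'v) query \<Rightarrow> bool" where
  "nentails C q \<longleftrightarrow> (\<forall>I. (\<forall>F\<in>C. I \<inter> F \<noteq> {}) \<longrightarrow> sat_query I q)"

lemma nondet_instance_chase:
  assumes "\<forall>\<sigma>\<in>\<Sigma>. wf_dtgd \<sigma>"
  shows "nondet_instance (chase \<nu> D \<Sigma>)"
proof -
  have "nondet_instance (chase_step \<nu> D \<Sigma> k)" for k
  proof (induction k)
    case 0
    then show ?case by (auto simp: nondet_instance_def)
  next
    case (Suc k)
    have "finite (res \<nu> Fs \<sigma> h) \<and> res \<nu> Fs \<sigma> h \<noteq> {}"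
      if "\<sigma> \<in> \<Sigma>" and ap: "applicable (chase_step \<nu> D \<Sigma> k) \<sigma> h Fs" for Fs \<sigma> h
    proof
      have "finite (Fs ! i)" if "i < length (body \<sigma>)" for i
      proof -
        have "Fs ! i \<in> set Fs" using that ap by (simp add: applicable_def)
        then show ?thesis using ap Suc by (auto simp: applicable_def nondet_instance_def)
      qed
      then show "finite (res \<nu> Fs \<sigma> h)"
        by (auto simp: res_def head_atoms_def)
      have "wf_dtgd \<sigma>" using assms \<open>\<sigma> \<in> \<Sigma>\<close> by blast
      then have "head_atoms \<sigma> \<noteq> {}"
        by (cases "disjuncts \<sigma>") (auto simp: wf_dtgd_def head_atoms_def)
      then show "res \<nu> Fs \<sigma> h \<noteq> {}" by (simp add: res_def)
    qed
    with Suc show ?case by (auto simp: nondet_instance_def)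
  qed
  then show ?thesis by (auto simp: chase_def nondet_instance_def)
qed

end

theory Submission
  imports Defs
begin

text \<open>
  If \<open>I\<close> meets every nondeterministic fact of the chase, then, these being finite, Zorn's lemma
  gives a minimal such \<open>J \<subseteq> I\<close>.  By minimality each \<open>\<alpha> \<in> J\<close> is the only element of \<open>J\<close> in
  some \<open>F\<close> of the chase; applying a DTGD to such sets \<open>F\<close> shows that \<open>J\<close> is a model of
  \<open>\<Sigma>\<close>.  Conversely, a model \<open>I\<close> of \<open>D\<close> and \<open>\<Sigma>\<close> yields a map \<open>g\<close> on values fixing the
  constants such that every nondeterministic fact of the chase contains some \<open>\<alpha>\<close> with
  \<open>g \<alpha> \<in> I\<close>; the set of all such \<open>\<alpha>\<close> satisfies \<open>q\<close>, and \<open>g\<close> carries this over to \<open>I\<close>.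
\<close>

section \<open>Homomorphisms\<close>

lemma map_atom_app:
  assumes "\<And>c. g (Const c) = Const c"
  shows "map_atom id g (app h a) = app (g \<circ> h) a"
proof -
  have "g (val_of h t) = val_of (g \<circ> h) t" for t
    using assms by (cases t) auto
  then show ?thesis by (simp add: app_def)
qed

text \<open>Queries are positive and existential: \<open>g\<close> carries atoms along, and the
  image of a witness for \<open>QEx\<close> is again a witness.\<close>

lemma holds_hom:
  assumes "\<And>c. g (Const c) = Const c"
    and "\<And>\<alpha>. \<alpha> \<in> J \<Longrightarrow> map_atom id g \<alpha> \<in> I"
    and "holds J h q"
  shows "holds I (g \<circ> h) q"
  using assms(3)
proof (induction q arbitrary: h)
  case (QAtom a)
  then show ?case using assms(2)[of "app h a"] map_atom_app[of g h a] assms(1) by (simp del: o_apply flip: comp_def)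
next
  case (QEx v q)
  then obtain t where "holds J (h(v := t)) q" by auto
  then have "holds I (g \<circ> h(v := t)) q" by (rule QEx.IH)
  then show ?case by (auto simp: fun_upd_comp simp del: o_apply simp flip: comp_def)
qed auto

lemma sat_query_hom:
  assumes "boolean_ucq q"
    and "\<And>c. g (Const c) = Const c"
    and "\<And>\<alpha>. \<alpha> \<in> J \<Longrightarrow> map_atom id g \<alpha> \<in> I"
    and "sat_query J q"
  shows "sat_query I q"
proof -
  have "holds J h q" for h using assms(4) by (simp add: sat_query_def)
  then have "holds I (g \<circ> h) q" for h
    using holds_hom[of g J I] assms(2,3) by blast
  \<comment> \<open>Only assignments of the form \<open>g \<circ> h\<close> have been reached; for a
    sentence one assignment suffices.\<close>
  then show ?thesis using sat_query_sentence[OF assms(1)] by blast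
qed

lemma set2_atom_app: "set2_atom (app h a) = val_of h ` set (args a)"
  by (simp add: app_def)

lemma val_of_eq_Const_or_var:
  "t \<in> set (args a) \<Longrightarrow> (\<exists>c. val_of h t = Const c) \<or> (\<exists>v \<in> set (atom_vars a). val_of h t = h v)"
  by (cases t) (auto simp: atom_vars_def intro!: bexI[of _ t])

lemma var_in_set2_atom_app:
  assumes "v \<in> set (atom_vars a)"
  shows "h v \<in> set2_atom (app h a)"
proof -
  obtain t where "t \<in> set (args a)" "v \<in> set (trm_vars t)"
    using assms by (auto simp: atom_vars_def)
  then have "h v = val_of h t" by (cases t rule: trm.exhaust) auto
  then show ?thesis using \<open>t \<in> set (args a)\<close> by (simp add: set2_atom_app)
qed

section \<open>Minimal hitting sets\<close>

text \<open>Zorn's lemma is applied upwards to complements: \<open>J\<close> is \<open>I - K\<close>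
  for a maximal \<open>K\<close> in \<open>\<K>\<close>, the family of sets whose removal from
  \<open>I\<close> still leaves a hitting set.\<close>

lemma minimal_hitting_set:
  assumes fin: "\<And>F. F \<in> C \<Longrightarrow> finite F" and hit: "\<And>F. F \<in> C \<Longrightarrow> I \<inter> F \<noteq> {}"
  shows "\<exists>J\<subseteq>I. (\<forall>F\<in>C. J \<inter> F \<noteq> {}) \<and> (\<forall>\<alpha>\<in>J. \<exists>F\<in>C. J \<inter> F = {\<alpha>})"
proof -
  define \<K> where "\<K> = {K. \<forall>F\<in>C. \<not> I \<inter> F \<subseteq> K}"
  have "\<Union>\<C> \<in> \<K>" if ne: "\<C> \<noteq> {}" and chain: "subset.chain \<K> \<C>" for \<C>
    unfolding \<K>_def mem_Collect_eq
  proof (intro ballI notI)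
    fix F assume F: "F \<in> C" and sub: "I \<inter> F \<subseteq> \<Union>\<C>"
    \<comment> \<open>Finiteness of \<open>F\<close> enters here: a finite set covered by a chain
      lies in one member.\<close>
    obtain K where "K \<in> \<C>" "I \<inter> F \<subseteq> K"
      by (rule finite_subset_Union_chain[OF finite_Int[OF disjI2[OF fin[OF F]]] sub ne chain])
    moreover have "K \<in> \<K>" using chain \<open>K \<in> \<C>\<close> by (auto simp: subset.chain_def)
    ultimately show False using F by (auto simp: \<K>_def)
  qed
  moreover have "{} \<in> \<K>" using hit by (auto simp: \<K>_def)
  ultimately obtain K where K: "K \<in> \<K>" and max: "\<And>L. L \<in> \<K> \<Longrightarrow> K \<subseteq> L \<Longrightarrow> L = K"
    using subset_Zorn_nonempty[of \<K>] by blast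
  have "\<exists>F\<in>C. (I - K) \<inter> F = {\<alpha>}" if "\<alpha> \<in> I - K" for \<alpha>
  proof -
    \<comment> \<open>By maximality, removing \<open>\<alpha>\<close> as well would miss some
      \<open>F\<close>, so \<open>\<alpha>\<close> is all that \<open>I - K\<close> has in common
      with \<open>F\<close>.\<close>
    have "insert \<alpha> K \<notin> \<K>" using max[of "insert \<alpha> K"] that by blast
    then obtain F where "F \<in> C" "I \<inter> F \<subseteq> insert \<alpha> K" by (auto simp: \<K>_def)
    moreover from this have "\<not> I \<inter> F \<subseteq> K" using K by (auto simp: \<K>_def)
    ultimately show ?thesis using that by blast
  qed
  moreover have "(I - K) \<inter> F \<noteq> {}" if "F \<in> C" for F
    using K that by (auto simp: \<K>_def)
  ultimately show ?thesis by (intro exI[of _ "I - K"]) auto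
qed

section \<open>Closure of the chase\<close>

lemma chase_step_mono: "k \<le> l \<Longrightarrow> chase_step \<nu> D \<Sigma> k \<subseteq> chase_step \<nu> D \<Sigma> l"
  by (rule lift_Suc_mono_le[of "chase_step \<nu> D \<Sigma>"]) auto

lemma finite_subset_chase_step:
  assumes "finite A" "A \<subseteq> chase \<nu> D \<Sigma>"
  shows "\<exists>k. A \<subseteq> chase_step \<nu> D \<Sigma> k"
  using assms
proof (induction rule: finite_induct)
  case (insert F A)
  then obtain k l where "A \<subseteq> chase_step \<nu> D \<Sigma> k" "F \<in> chase_step \<nu> D \<Sigma> l"
    by (auto simp: chase_def)
  then have "insert F A \<subseteq> chase_step \<nu> D \<Sigma> (max k l)"
    using chase_step_mono[of k "max k l" \<nu> D \<Sigma>] chase_step_mono[of l "max k l" \<nu> D \<Sigma>] by auto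
  then show ?case ..
qed simp

text \<open>A body is a finite list, so the nondeterministic facts used all occur at some stage
  \<open>k\<close>, and the result occurs at stage \<open>k + 1\<close>.\<close>

lemma res_in_chase:
  assumes "\<sigma> \<in> \<Sigma>" "applicable (chase \<nu> D \<Sigma>) \<sigma> h Fs"
  shows "res \<nu> Fs \<sigma> h \<in> chase \<nu> D \<Sigma>"
proof -
  obtain k where "set Fs \<subseteq> chase_step \<nu> D \<Sigma> k"
    using finite_subset_chase_step[of "set Fs" \<nu> D \<Sigma>] assms(2) by (auto simp: applicable_def)
  then have "applicable (chase_step \<nu> D \<Sigma> k) \<sigma> h Fs"
    using assms(2) by (simp add: applicable_def)
  then have "res \<nu> Fs \<sigma> h \<in> chase_step \<nu> D \<Sigma> (Suc k)" using assms(1) by auto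
  then show ?thesis unfolding chase_def by blast
qed

text \<open>Each body atom true in \<open>J\<close> is represented by a member of the chase meeting
  \<open>J\<close> in that atom alone. What is left over of these members avoids \<open>J\<close>,
  so \<open>J\<close> can hit the result only in a head atom.\<close>

lemma minimal_hitting_set_sat_dtgd:
  assumes \<sigma>: "\<sigma> \<in> \<Sigma>" "canonical \<sigma>"
    and hit: "\<And>F. F \<in> chase \<nu> D \<Sigma> \<Longrightarrow> J \<inter> F \<noteq> {}"
    and min: "\<And>\<alpha>. \<alpha> \<in> J \<Longrightarrow> \<exists>F\<in>chase \<nu> D \<Sigma>. J \<inter> F = {\<alpha>}"
  shows "sat_dtgd J \<sigma>"
  unfolding sat_dtgd_def
proof (intro allI impI)
  fix h assume body: "\<forall>a\<in>set (body \<sigma>). app h a \<in> J"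
  obtain W where W: "\<And>\<alpha>. \<alpha> \<in> J \<Longrightarrow> W \<alpha> \<in> chase \<nu> D \<Sigma> \<and> J \<inter> W \<alpha> = {\<alpha>}"
    using min by metis
  define Fs where "Fs = map (\<lambda>a. W (app h a)) (body \<sigma>)"
  have "applicable (chase \<nu> D \<Sigma>) \<sigma> h Fs"
    using W body by (fastforce simp: applicable_def Fs_def)
  then have "J \<inter> res \<nu> Fs \<sigma> h \<noteq> {}" using res_in_chase[OF \<sigma>(1)] hit by blast
  moreover have "J \<inter> (Fs ! i - {app h (body \<sigma> ! i)}) = {}" if "i < length (body \<sigma>)" for i
    using W[of "app h (body \<sigma> ! i)"] body that by (auto simp: Fs_def)
  ultimately obtain a where a: "a \<in> head_atoms \<sigma>" "app (extend \<nu> \<sigma> h) a \<in> J"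
    unfolding res_def by blast
  then obtain \<psi> where \<psi>: "\<psi> \<in> set (disjuncts \<sigma>)" "a \<in> set \<psi>" by (auto simp: head_atoms_def)
  \<comment> \<open>Canonicity: one true head atom is already a true disjunct.\<close>
  then have "set \<psi> = {a}" using \<sigma>(2) by (auto simp: canonical_def length_Suc_conv)
  moreover have "extend \<nu> \<sigma> h v = h v" if "v \<in> set (body_vars \<sigma>)" for v
    using that by (simp add: extend_def ex_vars_def)
  ultimately show "\<exists>h'. (\<forall>v\<in>set (body_vars \<sigma>). h' v = h v) \<and>
      (\<exists>\<psi>\<in>set (disjuncts \<sigma>). \<forall>a\<in>set \<psi>. app h' a \<in> J)"
    using a \<psi> by (intro exI[of _ "extend \<nu> \<sigma> h"] conjI bexI[of _ \<psi>]) auto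
qed

section \<open>Mapping the nulls of the chase into a model\<close>

text \<open>One assignment is chosen for all existential variables together, since a head atom
  constrains them jointly. It depends only on \<open>\<sigma>\<close> and the frontier values
  \<open>us\<close>, as nulls are named by \<open>\<sigma>\<close>, frontier values and a
  variable.\<close>

definition witness ::
  "('p, 'c, 'n) inst \<Rightarrow> ('p, 'c, 'v) dtgd \<Rightarrow> ('c, 'n) val list \<Rightarrow> 'v \<Rightarrow> ('c, 'n) val" where
  "witness I \<sigma> us = (SOME h. map h (frontier \<sigma>) = us \<and> (\<exists>a\<in>head_atoms \<sigma>. app h a \<in> I))"

lemma witness_sat:
  assumes "map h (frontier \<sigma>) = us" "a \<in> head_atoms \<sigma>" "app h a \<in> I"
  shows "map (witness I \<sigma> us) (frontier \<sigma>) = us \<and>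
    (\<exists>a\<in>head_atoms \<sigma>. app (witness I \<sigma> us) a \<in> I)"
  unfolding witness_def
  by (rule someI[of "\<lambda>h. map h (frontier \<sigma>) = us \<and> (\<exists>a\<in>head_atoms \<sigma>. app h a \<in> I)" h])
    (use assms in blast)

text \<open>
  The naming \<open>\<nu>\<close> may be circular, as in \<open>\<nu> (\<sigma>, [Null n], v) = n\<close>, so the map cannot be defined
  by recursion on nulls.  Its graph is defined inductively instead; nulls occurring in the chase of
  a database are created in a well-founded way and hence lie in its domain.
\<close>

inductive interp ::
  "('p, 'c, 'v, 'n) naming \<Rightarrow> ('p, 'c, 'v) dtgd set \<Rightarrow> ('p, 'c, 'n) inst \<Rightarrow>
   ('c, 'n) val \<Rightarrow> ('c, 'n) val \<Rightarrow> bool"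
  for \<nu> \<Sigma> I where
  Const: "interp \<nu> \<Sigma> I (Const c) (Const c)"
| Null: "(\<sigma>, ts, v) \<in> null_triples \<Sigma> \<Longrightarrow> list_all2 (interp \<nu> \<Sigma> I) ts us \<Longrightarrow>
    interp \<nu> \<Sigma> I (Null (\<nu> (\<sigma>, ts, v))) (witness I \<sigma> us v)"
monos list_all2_mono

text \<open>Injectivity of the naming recovers the triple from the null; the induction hypothesis
  then fixes the images of its frontier values.\<close>

lemma interp_functional:
  assumes "null_naming \<Sigma> \<nu>"
  shows "interp \<nu> \<Sigma> I t u \<Longrightarrow> interp \<nu> \<Sigma> I t u' \<Longrightarrow> u = u'"
proof (induction arbitrary: u' rule: interp.induct)
  case (Const c)
  then show ?case by (auto elim: interp.cases)
next
  case (Null \<sigma> ts v us)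
  from Null.prems obtain \<sigma>' ts' v' us' where
    eq: "\<nu> (\<sigma>, ts, v) = \<nu> (\<sigma>', ts', v')" "u' = witness I \<sigma>' us' v'"
    and tr: "(\<sigma>', ts', v') \<in> null_triples \<Sigma>"
    and ts': "list_all2 (interp \<nu> \<Sigma> I) ts' us'"
    by (auto elim: interp.cases)
  have same: "\<sigma>' = \<sigma>" "ts' = ts" "v' = v"
    using inj_onD[OF assms[unfolded null_naming_def] eq(1) Null.hyps tr] by auto
  have "us = us'"
    using Null.IH ts' unfolding same by (auto simp: list_all2_conv_all_nth intro: nth_equalityI)
  then show ?case using eq(2) same by simp
qed

definition interp_fun ::
  "('p, 'c, 'v, 'n) naming \<Rightarrow> ('p, 'c, 'v) dtgd set \<Rightarrow> ('p, 'c, 'n) inst \<Rightarrow>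
   ('c, 'n) val \<Rightarrow> ('c, 'n) val" where
  "interp_fun \<nu> \<Sigma> I t = (SOME u. interp \<nu> \<Sigma> I t u)"

lemma interp_fun_eq:
  "null_naming \<Sigma> \<nu> \<Longrightarrow> interp \<nu> \<Sigma> I t u \<Longrightarrow> interp_fun \<nu> \<Sigma> I t = u"
  unfolding interp_fun_def by (metis interp_functional someI)

lemma interp_fun_Const: "null_naming \<Sigma> \<nu> \<Longrightarrow> interp_fun \<nu> \<Sigma> I (Const c) = Const c"
  by (rule interp_fun_eq) (auto intro: interp.Const)

lemma interp_extend:
  assumes nn: "null_naming \<Sigma> \<nu>" and "\<sigma> \<in> \<Sigma>" "v \<in> ex_vars \<sigma>"
    and dom: "\<And>v. v \<in> set (body_vars \<sigma>) \<Longrightarrow> \<exists>u. interp \<nu> \<Sigma> I (h v) u"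
  shows "interp \<nu> \<Sigma> I (extend \<nu> \<sigma> h v)
           (witness I \<sigma> (map (interp_fun \<nu> \<Sigma> I \<circ> h) (frontier \<sigma>)) v)"
proof -
  have "interp \<nu> \<Sigma> I (h x) (interp_fun \<nu> \<Sigma> I (h x))" if "x \<in> set (frontier \<sigma>)" for x
    using dom[of x] that interp_fun_eq[OF nn] by (fastforce simp: frontier_def)
  then have "list_all2 (interp \<nu> \<Sigma> I) (map h (frontier \<sigma>))
      (map (interp_fun \<nu> \<Sigma> I \<circ> h) (frontier \<sigma>))"
    by (simp add: list_all2_conv_all_nth)
  then show ?thesis
    using assms(2,3) by (auto simp: extend_def null_triples_def intro!: interp.Null)
qed

text \<open>Induction on stages. The domain claim is carried along because a new null is sent to its
  witness value only once its frontier values are interpreted.\<close>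

lemma interp_fun_chase_step:
  assumes nn: "null_naming \<Sigma> \<nu>" and "database D" "D \<subseteq> I"
    and can: "\<And>\<sigma>. \<sigma> \<in> \<Sigma> \<Longrightarrow> canonical \<sigma>" and sat: "\<And>\<sigma>. \<sigma> \<in> \<Sigma> \<Longrightarrow> sat_dtgd I \<sigma>"
    and "F \<in> chase_step \<nu> D \<Sigma> k"
  shows "(\<forall>\<alpha>\<in>F. \<forall>t\<in>set2_atom \<alpha>. \<exists>u. interp \<nu> \<Sigma> I t u) \<and>
    (\<exists>\<alpha>\<in>F. map_atom id (interp_fun \<nu> \<Sigma> I) \<alpha> \<in> I)"
  using assms(6)
proof (induction k arbitrary: F)
  case 0
  then obtain \<alpha> where \<alpha>: "F = {\<alpha>}" "\<alpha> \<in> D" by auto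
  have const: "\<exists>c. t = Const c" if "t \<in> set2_atom \<alpha>" for t
    using \<alpha>(2) assms(2) that by (cases \<alpha>) (auto simp: database_def null_free_def)
  then have "map_atom id (interp_fun \<nu> \<Sigma> I) \<alpha> = map_atom id id \<alpha>"
    by (intro atom.map_cong) (use interp_fun_Const[OF nn] in auto)
  then have "map_atom id (interp_fun \<nu> \<Sigma> I) \<alpha> = \<alpha>" by (simp add: atom.map_id)
  then show ?case using \<alpha> assms(3) const interp.Const by fastforce
next
  case (Suc k)
  let ?g = "interp_fun \<nu> \<Sigma> I"
  from Suc.prems consider "F \<in> chase_step \<nu> D \<Sigma> k" |
    Fs \<sigma> h where "F = res \<nu> Fs \<sigma> h" "\<sigma> \<in> \<Sigma>" "applicable (chase_step \<nu> D \<Sigma> k) \<sigma> h Fs"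
    by auto
  then show ?case
  proof cases
    case 1
    then show ?thesis by (rule Suc.IH)
  next
    case 2
    note \<sigma> = \<open>\<sigma> \<in> \<Sigma>\<close>
    have Fs: "Fs ! i \<in> chase_step \<nu> D \<Sigma> k" "app h (body \<sigma> ! i) \<in> Fs ! i"
      if "i < length (body \<sigma>)" for i
      using 2(3) that by (auto simp: applicable_def)
    have dom: "\<exists>u. interp \<nu> \<Sigma> I (h v) u" if "v \<in> set (body_vars \<sigma>)" for v
    proof -
      from that obtain a where "a \<in> set (body \<sigma>)" and v: "v \<in> set (atom_vars a)"
        by (auto simp: body_vars_def)
      then obtain i where "i < length (body \<sigma>)" "a = body \<sigma> ! i"
        by (auto simp: in_set_conv_nth)
      then show ?thesis using Suc.IH[OF Fs(1)] Fs(2) var_in_set2_atom_app[OF v] by blast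
    qed
    let ?w = "witness I \<sigma> (map (?g \<circ> h) (frontier \<sigma>))"
    have ext: "interp \<nu> \<Sigma> I (extend \<nu> \<sigma> h v) (?w v)" if "v \<in> ex_vars \<sigma>" for v
      using interp_extend[OF nn \<sigma> that] dom by blast
    have head_dom: "\<exists>u. interp \<nu> \<Sigma> I (extend \<nu> \<sigma> h v) u" if "v \<in> head_vars \<sigma>" for v
    proof (cases "v \<in> ex_vars \<sigma>")
      case True
      then show ?thesis using ext by blast
    next
      case False
      then show ?thesis using dom[of v] that by (simp add: extend_def ex_vars_def)
    qed
    have "\<exists>u. interp \<nu> \<Sigma> I t u" if "\<alpha> \<in> F" "t \<in> set2_atom \<alpha>" for \<alpha> t
    proof -
      from that(1) 2(1) consider a where "a \<in> head_atoms \<sigma>" "\<alpha> = app (extend \<nu> \<sigma> h) a" |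
        i where "i < length (body \<sigma>)" "\<alpha> \<in> Fs ! i"
        by (auto simp: res_def)
      then show ?thesis
      proof cases
        case (1 a)
        with that(2) obtain s where s: "s \<in> set (args a)" "t = val_of (extend \<nu> \<sigma> h) s"
          by (auto simp: set2_atom_app)
        show ?thesis
          using val_of_eq_Const_or_var[OF s(1), of "extend \<nu> \<sigma> h"] s(2) 1(1) head_dom
            interp.Const[of \<nu> \<Sigma> I]
          by (fastforce simp: head_vars_def)
      next
        case (2 i)
        then show ?thesis using Suc.IH[OF Fs(1)] that(2) by blast
      qed
    qed
    \<comment> \<open>Either the whole body is mapped into \<open>I\<close> and a head atom follows,
      or some body atom fails in \<open>I\<close> and another element of its nondeterministic fact,
      kept in the result, is mapped into \<open>I\<close>.\<close>
    moreover have "\<exists>\<alpha>\<in>F. map_atom id ?g \<alpha> \<in> I"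
    proof (cases "\<forall>a\<in>set (body \<sigma>). app (?g \<circ> h) a \<in> I")
      case True
      then obtain h' \<psi> where h': "\<forall>v\<in>set (body_vars \<sigma>). h' v = (?g \<circ> h) v"
        and \<psi>: "\<psi> \<in> set (disjuncts \<sigma>)" "\<forall>a\<in>set \<psi>. app h' a \<in> I"
        using sat[OF \<sigma>] unfolding sat_dtgd_def by blast
      have "hd \<psi> \<in> set \<psi>"
        using can[OF \<sigma>] \<psi>(1) by (fastforce simp: canonical_def intro: hd_in_set)
      then have "hd \<psi> \<in> head_atoms \<sigma> \<and> app h' (hd \<psi>) \<in> I"
        using \<psi> by (auto simp: head_atoms_def)
      moreover have "map h' (frontier \<sigma>) = map (?g \<circ> h) (frontier \<sigma>)"
        using h' by (auto simp: frontier_def)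
      \<comment> \<open>The assignment \<open>h'\<close> need not be the one chosen by
        \<open>witness\<close>, but it shows that the choice succeeds.\<close>
      ultimately have "map ?w (frontier \<sigma>) = map (?g \<circ> h) (frontier \<sigma>) \<and>
          (\<exists>a\<in>head_atoms \<sigma>. app ?w a \<in> I)"
        using witness_sat by metis
      then obtain a where w: "\<And>v. v \<in> set (frontier \<sigma>) \<Longrightarrow> ?w v = ?g (h v)"
        and a: "a \<in> head_atoms \<sigma>" "app ?w a \<in> I"
        by auto
      \<comment> \<open>A variable of a head atom is existential, so that its null goes to the
        witness value, or lies in the frontier, where both sides agree.\<close>
      have "(?g \<circ> extend \<nu> \<sigma> h) v = ?w v" if "v \<in> set (atom_vars a)" for v
      proof (cases "v \<in> ex_vars \<sigma>")
        case True
        then show ?thesis using interp_fun_eq[OF nn ext] by simp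
      next
        case False
        then have "v \<in> set (frontier \<sigma>)"
          using that a(1) by (auto simp: ex_vars_def frontier_def head_vars_def)
        then show ?thesis using w False by (simp add: extend_def)
      qed
      then have "map_atom id ?g (app (extend \<nu> \<sigma> h) a) = app ?w a"
        using app_cong[of a "?g \<circ> extend \<nu> \<sigma> h" ?w] map_atom_app[of ?g] interp_fun_Const[OF nn]
        by metis
      then show ?thesis
        using a 2(1) by (intro bexI[of _ "app (extend \<nu> \<sigma> h) a"]) (auto simp: res_def)
    next
      case False
      then obtain i where i: "i < length (body \<sigma>)" "app (?g \<circ> h) (body \<sigma> ! i) \<notin> I"
        by (auto simp: in_set_conv_nth)
      obtain \<alpha> where \<alpha>: "\<alpha> \<in> Fs ! i" "map_atom id ?g \<alpha> \<in> I"
        using Suc.IH[OF Fs(1)[OF i(1)]] by blast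
      have "\<alpha> \<noteq> app h (body \<sigma> ! i)"
        using \<alpha>(2) i(2) map_atom_app[of ?g h] interp_fun_Const[OF nn] by metis
      then show ?thesis using \<alpha> i(1) 2(1) by (intro bexI[of _ \<alpha>]) (auto simp: res_def)
    qed
    ultimately show ?thesis by blast
  qed
qed

theorem theorem2:
  fixes \<Sigma> :: "('p, 'c, 'v) dtgd set"
    and D :: "('p, 'c, 'n) inst"
    and q :: "('p, 'c, 'v) query"
    and \<nu> :: "('p, 'c, 'v, 'n) naming"
  assumes "null_naming \<Sigma> \<nu>"
    and "\<forall>\<sigma>\<in>\<Sigma>. wf_dtgd \<sigma> \<and> canonical \<sigma>"
    and "database D"
    and "boolean_ucq q"
  shows "entails D \<Sigma> q \<longleftrightarrow> nentails (chase \<nu> D \<Sigma>) q"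
proof
  assume ent: "entails D \<Sigma> q"
  show "nentails (chase \<nu> D \<Sigma>) q"
    unfolding nentails_def
  proof (intro allI impI)
    fix I assume hit: "\<forall>F\<in>chase \<nu> D \<Sigma>. I \<inter> F \<noteq> {}"
    have fin: "finite F" if "F \<in> chase \<nu> D \<Sigma>" for F
      using nondet_instance_chase[of \<Sigma> \<nu> D] assms(2) that by (auto simp: nondet_instance_def)
    obtain J where J: "J \<subseteq> I" "\<forall>F\<in>chase \<nu> D \<Sigma>. J \<inter> F \<noteq> {}"
      "\<forall>\<alpha>\<in>J. \<exists>F\<in>chase \<nu> D \<Sigma>. J \<inter> F = {\<alpha>}"
      using minimal_hitting_set[of "chase \<nu> D \<Sigma>" I, OF fin bspec[OF hit]] by auto
    \<comment> \<open>Hitting the singletons of stage 0 forces all of \<open>D\<close> into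
      \<open>J\<close>.\<close>
    have "{\<alpha>} \<in> chase \<nu> D \<Sigma>" if "\<alpha> \<in> D" for \<alpha>
      using that unfolding chase_def by (intro UN_I[of 0]) auto
    then have "D \<subseteq> J" using J(2) by blast
    moreover have "sat_dtgd J \<sigma>" if "\<sigma> \<in> \<Sigma>" for \<sigma>
      using minimal_hitting_set_sat_dtgd[OF that _ bspec[OF J(2)] bspec[OF J(3)]] assms(2) that
      by simp
    ultimately have "sat_query J q" using ent by (simp add: entails_def)
    then show "sat_query I q"
      using sat_query_hom[OF assms(4), of id J I] J(1) by (auto simp: atom.map_id)
  qed
next
  assume nent: "nentails (chase \<nu> D \<Sigma>) q"
  show "entails D \<Sigma> q"
    unfolding entails_def
  proof (intro allI impI)
    fix I assume I: "D \<subseteq> I \<and> (\<forall>\<sigma>\<in>\<Sigma>. sat_dtgd I \<sigma>)"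
    \<comment> \<open>The full preimage of \<open>I\<close> is taken, including facts with nulls
      outside the domain of \<open>interp\<close>. The arbitrary values there do no harm:
      \<open>J\<close> only has to map into \<open>I\<close> and hit the chase.\<close>
    define J where "J = {\<alpha>. map_atom id (interp_fun \<nu> \<Sigma> I) \<alpha> \<in> I}"
    have "J \<inter> F \<noteq> {}" if "F \<in> chase \<nu> D \<Sigma>" for F
    proof -
      from that obtain k where "F \<in> chase_step \<nu> D \<Sigma> k" by (auto simp: chase_def)
      then have "\<exists>\<alpha>\<in>F. map_atom id (interp_fun \<nu> \<Sigma> I) \<alpha> \<in> I"
        using interp_fun_chase_step[OF assms(1,3), of I F k] assms(2) I by blast
      then show ?thesis by (auto simp: J_def)
    qed
    then have "sat_query J q" using nent by (simp add: nentails_def)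
    then show "sat_query I q"
      using sat_query_hom[OF assms(4), of "interp_fun \<nu> \<Sigma> I" J I] interp_fun_Const[OF assms(1)]
      by (simp add: J_def)
  qed
qed

end
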